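(* Let $A\in\mathbb{R}^{d\times n}$. Then the distance from the origin to the convex hull of the columns of $A$ equals $\rho_A^+$: $$\rho_A^+=\inf_{p\in\triangle}\|p\|_G=\inf_{p\in\triangle}\|Ap\|.$$
   Context: $\mathrm{lin}(A)=\{A\alpha:\alpha\in\mathbb{R}^n\}\subseteq\mathbb{R}^d$ is the linear span of the columns of $A$; $\triangle=\{p\in\mathbb{R}^n: p\ge\mathbf{0},\ \|p\|_1=1\}$ is the probability simplex; $\|\cdot\|$ is the Euclidean norm; $G=A^TA$ and $\|\alpha\|_G=\sqrt{\alpha^TG\alpha}=\|A\alpha\|$ for $\alpha\in\mathbb{R}^n$. The affine-margin of $A$ is $\rho_A:=\sup\{\inf_{p\in\triangle}w^TAp : w\in\mathrm{lin}(A),\ \|w\|=1\}$ (with $\sup\emptyset=-\infty$, relevant only if $A=0$), and $\rho_A^+:=\max\{0,\rho_A\}$. *)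

theory Defs
  imports "HOL-Analysis.Analysis"
begin

text \<open>
  A matrix with \<open>d\<close> rows and \<open>n\<close> columns has type \<open>real ^ 'n ^ 'd\<close>, where \<open>d\<close> and \<open>n\<close> are the
  cardinalities of the (arbitrary) finite index types \<open>'d\<close> and \<open>'n\<close>.
\<close>

definition lin :: "real ^ 'n ^ 'd \<Rightarrow> (real ^ 'd) set" where
  "lin A = {A *v \<alpha> | \<alpha>. True}"

definition prob_simplex :: "(real ^ 'n) set" where
  "prob_simplex = {p. (\<forall>i. 0 \<le> p $ i) \<and> (\<Sum>i\<in>UNIV. \<bar>p $ i\<bar>) = 1}"

definition gram :: "real ^ 'n ^ 'd \<Rightarrow> real ^ 'n ^ 'n" where
  "gram A = transpose A ** A"

definition G_norm :: "real ^ 'n ^ 'd \<Rightarrow> real ^ 'n \<Rightarrow> real" where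
  "G_norm A \<alpha> = sqrt (\<alpha> \<bullet> (gram A *v \<alpha>))"

text \<open>
  Suprema and infima are taken in the extended reals, so that the supremum over the empty set
  (which occurs exactly when \<open>A = 0\<close>) is \<open>-\<infinity>\<close>, and no unspecified value of the
  real-valued \<open>Sup\<close> or \<open>Inf\<close> can enter.
\<close>

definition affine_margin :: "real ^ 'n ^ 'd \<Rightarrow> ereal" where
  "affine_margin A =
     (SUP w \<in> {w \<in> lin A. norm w = 1}. INF p \<in> prob_simplex. ereal (w \<bullet> (A *v p)))"

definition affine_margin_pos :: "real ^ 'n ^ 'd \<Rightarrow> ereal" where
  "affine_margin_pos A = max 0 (affine_margin A)"

end

theory Submission
  imports Defs
begin

text \<open>
  Let \<open>x\<close> be the point of the convex hull closest to the origin. By Cauchy--Schwarz, no unit vector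
  \<open>w\<close> achieves a margin above \<open>norm x\<close>. If \<open>x \<noteq> 0\<close>, then \<open>w = x / norm x\<close> lies in the span of the
  columns and achieves the margin \<open>norm x\<close>, because the obtuse-angle property of the projection gives
  \<open>x \<bullet> y \<ge> x \<bullet> x\<close> for all \<open>y\<close> in the hull.
\<close>

lemma convex_prob_simplex: "convex (prob_simplex :: (real ^ 'n) set)"
proof (rule convexI)
  fix p q :: "real ^ 'n" and u v :: real
  assume "p \<in> prob_simplex" "q \<in> prob_simplex" and uv: "0 \<le> u" "0 \<le> v" "u + v = 1"
  then have nn: "\<And>i. 0 \<le> p $ i" "\<And>i. 0 \<le> q $ i"
    and "(\<Sum>i\<in>UNIV. p $ i) = 1" "(\<Sum>i\<in>UNIV. q $ i) = 1"
    by (auto simp: prob_simplex_def)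
  then have "(\<Sum>i\<in>UNIV. u * p $ i + v * q $ i) = 1"
    using uv by (simp add: sum.distrib flip: sum_distrib_left)
  then show "u *\<^sub>R p + v *\<^sub>R q \<in> prob_simplex"
    using nn uv by (simp add: prob_simplex_def)
qed

lemma axis_in_prob_simplex: "axis i 1 \<in> prob_simplex"
  by (simp add: prob_simplex_def axis_def if_distrib cong: if_cong)

text \<open>\<open>A *v p\<close> is the combination of the columns with weights \<open>p\<close>,
  which gives one inclusion. Conversely, the image is convex and contains each column as the image
  of an axis vector, so it contains the hull.\<close>

lemma image_prob_simplex:
  fixes A :: "real ^ 'n ^ 'd"
  shows "(*v) A ` prob_simplex = convex hull (columns A)"
proof
  show "(*v) A ` prob_simplex \<subseteq> convex hull (columns A)"
  proof clarify
    fix p :: "real ^ 'n" assume "p \<in> prob_simplex"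
    then have p: "\<And>i. 0 \<le> p $ i" "(\<Sum>i\<in>UNIV. p $ i) = 1"
      by (auto simp: prob_simplex_def)
    have "(\<Sum>i\<in>UNIV. p $ i *\<^sub>R column i A) \<in> convex hull (columns A)"
      by (rule convex_sum) (auto simp: p columns_def intro: hull_inc)
    then show "A *v p \<in> convex hull (columns A)"
      by (simp add: matrix_mult_sum scalar_mult_eq_scaleR)
  qed
  show "convex hull (columns A) \<subseteq> (*v) A ` prob_simplex"
  proof (rule hull_minimal)
    show "columns A \<subseteq> (*v) A ` prob_simplex"
      using axis_in_prob_simplex by (force simp: columns_def simp flip: matrix_vector_mult_basis)
    show "convex ((*v) A ` prob_simplex)"
      by (intro convex_linear_image convex_prob_simplex matrix_vector_mul_linear)
  qed
qed

lemma G_norm_eq_norm: "G_norm A \<alpha> = norm (A *v \<alpha>)"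
proof -
  have "\<alpha> \<bullet> (gram A *v \<alpha>) = (A *v \<alpha>) \<bullet> (A *v \<alpha>)"
    by (simp add: gram_def inner_commute[of \<alpha>] dot_lmul_matrix flip: matrix_vector_mul_assoc)
  then show ?thesis
    by (simp add: G_norm_def norm_eq_sqrt_inner)
qed

text \<open>The hull of finitely many columns is compact and nonempty, so its distance to the origin
  is attained. The closest point is passed on through its weights \<open>p\<close>, the form in
  which the margin is stated.\<close>

lemma closest_hull_point:
  fixes A :: "real ^ 'n ^ 'd"
  obtains p where "p \<in> prob_simplex" "infdist 0 (convex hull (columns A)) = norm (A *v p)"
    "\<And>q. q \<in> prob_simplex \<Longrightarrow> (A *v p) \<bullet> (A *v p) \<le> (A *v p) \<bullet> (A *v q)"
proof -
  let ?C = "convex hull (columns A)"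
  have "finite (columns A)"
    by (simp add: columns_def full_SetCompr_eq)
  then have C: "closed ?C" "?C \<noteq> {}"
    by (auto simp: compact_imp_closed finite_imp_compact_convex_hull columns_def)
  then obtain x where x: "x \<in> ?C" "infdist 0 ?C = norm x"
    using infdist_attains_inf[of ?C 0] by (auto simp: dist_norm)
  have "\<forall>z\<in>?C. dist 0 x \<le> dist 0 z"
    using x(2) infdist_le[of _ ?C 0] by (auto simp: dist_norm)
  \<comment> \<open>Projecting the origin onto the convex hull gives
    \<open>(0 - x) \<bullet> (y - x) \<le> 0\<close>, which rearranges to this.\<close>
  then have "x \<bullet> x \<le> x \<bullet> y" if "y \<in> ?C" for y
    using any_closest_point_dot[of ?C x y 0] C x(1) that by (simp add: inner_diff_right)
  then show thesis
    using that x by (auto simp flip: image_prob_simplex)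
qed

lemma INF_norm_prob_simplex:
  fixes A :: "real ^ 'n ^ 'd"
  shows "(INF p \<in> prob_simplex. ereal (norm (A *v p))) = ereal (infdist 0 (convex hull (columns A)))"
proof (rule antisym)
  obtain p where "p \<in> prob_simplex" "infdist 0 (convex hull (columns A)) = norm (A *v p)"
    by (rule closest_hull_point)
  then show "(INF p \<in> prob_simplex. ereal (norm (A *v p)))
      \<le> ereal (infdist 0 (convex hull (columns A)))"
    by (auto intro: INF_lower2)
  have "infdist 0 (convex hull (columns A)) \<le> norm (A *v q)" if "q \<in> prob_simplex" for q
    using infdist_le[of "A *v q" "convex hull (columns A)" 0] that
    by (auto simp flip: image_prob_simplex)
  then show "ereal (infdist 0 (convex hull (columns A)))
      \<le> (INF p \<in> prob_simplex. ereal (norm (A *v p)))"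
    by (auto intro: INF_greatest)
qed

text \<open>Cauchy--Schwarz holds at each \<open>p\<close>, hence for the infima, uniformly in the
  unit vector \<open>w\<close>. For \<open>A = 0\<close> no \<open>w\<close> exists and the bound is
  vacuous.\<close>

lemma affine_margin_le: "affine_margin A \<le> (INF p \<in> prob_simplex. ereal (norm (A *v p)))"
  unfolding affine_margin_def
proof (intro SUP_least INF_mono')
  fix w p assume "w \<in> {w \<in> lin A. norm w = 1}"
  then show "ereal (w \<bullet> (A *v p)) \<le> ereal (norm (A *v p))"
    using norm_cauchy_schwarz[of w "A *v p"] by simp
qed

lemma infdist_le_affine_margin_pos:
  fixes A :: "real ^ 'n ^ 'd"
  shows "ereal (infdist 0 (convex hull (columns A))) \<le> affine_margin_pos A"
proof -
  obtain p where p: "infdist 0 (convex hull (columns A)) = norm (A *v p)"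
    "\<And>q. q \<in> prob_simplex \<Longrightarrow> (A *v p) \<bullet> (A *v p) \<le> (A *v p) \<bullet> (A *v q)"
    using closest_hull_point[of A] by blast
  show ?thesis
  proof (cases "A *v p = 0")
    case True
    then show ?thesis
      by (simp add: p(1) affine_margin_pos_def flip: zero_ereal_def)
  next
    case False
    define w where "w = (A *v p) /\<^sub>R norm (A *v p)"
    have "w = A *v (p /\<^sub>R norm (A *v p))"
      by (simp add: w_def matrix_vector_mult_scaleR)
    then have "w \<in> lin A"
      by (auto simp: lin_def)
    moreover have "norm w = 1"
      using False by (simp add: w_def)
    ultimately have w: "w \<in> {w \<in> lin A. norm w = 1}"
      by simp
    \<comment> \<open>This is the obtuse-angle inequality divided by
      \<open>norm (A *v p)\<close>.\<close>
    have "norm (A *v p) \<le> w \<bullet> (A *v q)" if "q \<in> prob_simplex" for q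
      using p(2)[OF that] False
      by (simp add: w_def field_simps dot_square_norm power2_eq_square)
    then have "ereal (norm (A *v p)) \<le> affine_margin A"
      unfolding affine_margin_def by (intro SUP_upper2[OF w] INF_greatest) simp
    then show ?thesis
      by (simp add: p(1) affine_margin_pos_def le_max_iff_disj)
  qed
qed

theorem proposition1:
  fixes A :: "real ^ 'n ^ 'd"
  shows "ereal (infdist 0 (convex hull (columns A))) = affine_margin_pos A
    \<and> affine_margin_pos A = (INF p \<in> prob_simplex. ereal (G_norm A p))
    \<and> (INF p \<in> prob_simplex. ereal (G_norm A p)) = (INF p \<in> prob_simplex. ereal (norm (A *v p)))"
proof -
  \<comment> \<open>Distances are nonnegative, so the bound on the margin survives taking the
    maximum with 0.\<close>
  have "affine_margin_pos A \<le> ereal (infdist 0 (convex hull (columns A)))"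
    using affine_margin_le[of A]
    by (simp add: affine_margin_pos_def INF_norm_prob_simplex infdist_nonneg)
  then have "ereal (infdist 0 (convex hull (columns A))) = affine_margin_pos A"
    using infdist_le_affine_margin_pos by (rule antisym[rotated])
  then show ?thesis
    by (simp add: G_norm_eq_norm INF_norm_prob_simplex)
qed

end
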